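(* Let $\ell\in\mathbb{Z}_+$ and let $D$ be a digraph with a vertex $r$ that is $r$-rooted $(\ell+1)$-arc-connected. Then the minimum number of colors in an arc-$\ell$-color-avoiding $r$-rooted 1-connected coloring of $D$ is $\ell+1$.
   Context: Digraphs may have loops and parallel arcs. A digraph with vertex $r$ is $r$-rooted $k$-arc-connected if it has at least two vertices and there are at least $k$ pairwise arc-disjoint dipaths from $r$ to every other vertex, or if it is a one-vertex digraph with at least $k$ loops; $r$-rooted 1-connected means that every vertex is reachable from $r$ by a dipath. An arc-coloring $f\colon E(D)\to C$ ($C$ finite) is arc-$\ell$-color-avoiding $r$-rooted 1-connected if for every $C'\subseteq C$ with $|C'|\le\ell$, after deleting all arcs whose color lies in $C'$, every vertex is still reachable from $r$ by a dipath.
   Formalization: For one-vertex digraphs, r-rooted 1-connected is taken to require at least one loop, also after deleting colors; with bare reachability one color would suffice on a single vertex with ℓ+1 loops, so the claim would fail for ℓ ≥ 1. Digraphs are taken to be finite. *)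

theory Defs
  imports "Graph_Theory.Arc_Walk" "HOL-Library.FuncSet"
begin

definition loops_at :: "('a, 'b) pre_digraph \<Rightarrow> 'a \<Rightarrow> 'b set" where
  "loops_at D r = {e \<in> arcs D. tail D e = r \<and> head D e = r}"

text \<open>
  Paths are lists of arcs, so for a target different from the root, pairwise arc-disjoint paths
  are nonempty and hence automatically pairwise distinct.
\<close>

definition rooted_arc_connected :: "('a, 'b) pre_digraph \<Rightarrow> 'a \<Rightarrow> nat \<Rightarrow> bool" where
  "rooted_arc_connected D r k \<longleftrightarrow>
     (card (verts D) \<ge> 2 \<and>
        (\<forall>v \<in> verts D - {r}. \<exists>P :: nat \<Rightarrow> 'b list.
           (\<forall>i<k. pre_digraph.apath D r (P i) v) \<and>
           (\<forall>i<k. \<forall>j<k. i \<noteq> j \<longrightarrow> set (P i) \<inter> set (P j) = {})))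
   \<or> (card (verts D) = 1 \<and> card (loops_at D r) \<ge> k)"

text \<open>
  Rooted 1-connectivity is reachability of every vertex from the root. The second conjunct only
  concerns one-vertex digraphs: there, the convention for rooted \<open>k\<close>-arc-connectivity asks for
  \<open>k\<close> loops, and we keep that convention for \<open>k = 1\<close>. Without it, every coloring of a one-vertex
  digraph would be color-avoiding connected, however few colors it uses.
\<close>

definition rooted_1_connected :: "('a, 'b) pre_digraph \<Rightarrow> 'a \<Rightarrow> bool" where
  "rooted_1_connected D r \<longleftrightarrow>
     (\<forall>v \<in> verts D. \<exists>p. pre_digraph.apath D r p v) \<and>
     (card (verts D) = 1 \<longrightarrow> loops_at D r \<noteq> {})"

lemma (in fin_digraph) rooted_1_connected_iff:
  assumes r: "r \<in> verts G"
  shows "rooted_1_connected G r \<longleftrightarrow> rooted_arc_connected G r 1"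
proof -
  have triv: "apath r [] r"
    using r by (simp add: apath_def awalk_Nil_iff)
  show ?thesis
  proof (cases "card (verts G) = 1")
    case True
    then have "verts G = {r}"
      using r by (metis card_1_singletonE singletonD)
    then have reach: "\<forall>v \<in> verts G. \<exists>p. apath r p v"
      using triv by (metis singletonD)
    have "finite (loops_at G r)"
      by (simp add: loops_at_def)
    then have "loops_at G r \<noteq> {} \<longleftrightarrow> card (loops_at G r) \<ge> 1"
      by (simp add: Suc_le_eq card_gt_0_iff)
    with True reach show ?thesis
      unfolding rooted_1_connected_def rooted_arc_connected_def by simp
  next
    case False
    have "card (verts G) > 0"
      using r card_gt_0_iff finite_verts by blast
    with False have two: "card (verts G) \<ge> 2" by linarith
    have "(\<exists>P :: nat \<Rightarrow> 'b list. (\<forall>i<1. apath r (P i) v) \<and>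
             (\<forall>i<1. \<forall>j<1. i \<noteq> j \<longrightarrow> set (P i) \<inter> set (P j) = {}))
          \<longleftrightarrow> (\<exists>p. apath r p v)" (is "?L v \<longleftrightarrow> ?R v") for v
    proof
      assume "?L v" then show "?R v" by (meson zero_less_one)
    next
      assume "?R v"
      then obtain p where "apath r p v" ..
      then show "?L v" by (intro exI[where x = "\<lambda>_. p"]) simp
    qed
    moreover have "(\<forall>v \<in> verts G. ?R v) \<longleftrightarrow> (\<forall>v \<in> verts G - {r}. ?R v)"
      using triv by (metis DiffD1 DiffI singletonD)
    ultimately show ?thesis
      unfolding rooted_1_connected_def rooted_arc_connected_def
      using False two by presburger
  qed
qed

definition delete_arcs :: "('a, 'b) pre_digraph \<Rightarrow> 'b set \<Rightarrow> ('a, 'b) pre_digraph" where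
  "delete_arcs D F = D\<lparr>arcs := arcs D - F\<rparr>"

definition color_avoiding_rooted_1_connected ::
    "('a, 'b) pre_digraph \<Rightarrow> 'a \<Rightarrow> nat \<Rightarrow> 'c set \<Rightarrow> ('b \<Rightarrow> 'c) \<Rightarrow> bool" where
  "color_avoiding_rooted_1_connected D r l C f \<longleftrightarrow>
     finite C \<and> f \<in> arcs D \<rightarrow> C \<and>
     (\<forall>C' \<subseteq> C. card C' \<le> l \<longrightarrow>
        rooted_1_connected (delete_arcs D {e \<in> arcs D. f e \<in> C'}) r)"

text \<open>
  The numbers of colors that occur on the arcs of such a coloring. Color sets are finite, so
  taking colors from \<^typ>\<open>nat\<close> loses no generality.
\<close>

definition color_avoiding_color_numbers :: "('a, 'b) pre_digraph \<Rightarrow> 'a \<Rightarrow> nat \<Rightarrow> nat set" where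
  "color_avoiding_color_numbers D r l =
     {card (f ` arcs D) | (f :: 'b \<Rightarrow> nat) C. color_avoiding_rooted_1_connected D r l C f}"

end

theory Submission
  imports Defs
begin

text \<open>
  The upper bound is Edmonds' theorem on disjoint spanning arborescences: give each of \<open>l + 1\<close>
  disjoint arborescences its own color, so that deleting \<open>l\<close> colors leaves one of them intact.
  Edmonds' theorem is proved by Lovasz's argument: grow an arborescence arc by arc such that
  every cut keeps enough of the remaining arcs. An arc that leaves the current tree inside an
  inclusion-minimal tight set can always be added, because by submodularity the
  intersection of two tight sets is tight.
  For the lower bound, with at most \<open>l\<close> colors one may delete all arcs.
\<close>

section \<open>Cuts and their submodularity\<close>

context pre_digraph
begin

text \<open>The arc set is a parameter, so that the remaining arcs and single color classes are
  measured in one fixed digraph.\<close>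

definition entering :: "'b set \<Rightarrow> 'a set \<Rightarrow> 'b set" where
  "entering A X = {e \<in> A. tail G e \<notin> X \<and> head G e \<in> X}"

lemma finite_entering: "finite A \<Longrightarrow> finite (entering A X)"
  by (simp add: entering_def)

text \<open>An arc entering \<open>X \<inter> Y\<close> or \<open>X \<union> Y\<close> enters
  \<open>X\<close> or \<open>Y\<close>, and an arc entering both of the former enters both of the
  latter.\<close>

lemma card_entering_submodular:
  assumes "finite A"
  shows "card (entering A (X \<inter> Y)) + card (entering A (X \<union> Y))
         \<le> card (entering A X) + card (entering A Y)"
proof -
  let ?I = "entering A (X \<inter> Y)" and ?U = "entering A (X \<union> Y)"
  let ?X = "entering A X" and ?Y = "entering A Y"
  note fin = finite_entering[OF assms]
  have "card ?I + card ?U = card (?I \<union> ?U) + card (?I \<inter> ?U)"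
    by (rule card_Un_Int) (simp_all add: fin)
  also have "\<dots> \<le> card (?X \<union> ?Y) + card (?X \<inter> ?Y)"
    by (intro add_mono card_mono) (auto simp: fin, auto simp: entering_def)
  also have "\<dots> = card ?X + card ?Y"
    by (rule card_Un_Int[symmetric]) (simp_all add: fin)
  finally show ?thesis .
qed

definition root_cut :: "'a \<Rightarrow> 'a set \<Rightarrow> bool" where
  "root_cut r X \<longleftrightarrow> X \<subseteq> verts G - {r} \<and> X \<noteq> {}"

text \<open>
  That \<open>F\<close> connects \<open>r\<close> to all of \<open>W\<close> is expressed by cuts, so that no dipaths are needed before
  the end; nothing requires \<open>F\<close> to be a tree.
\<close>

definition partial_branching :: "'a \<Rightarrow> 'b set \<Rightarrow> nat \<Rightarrow> 'a set \<Rightarrow> 'b set \<Rightarrow> bool" where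
  "partial_branching r A k W F \<longleftrightarrow>
     r \<in> W \<and> W \<subseteq> verts G \<and> F \<subseteq> A \<and> (\<forall>e\<in>F. tail G e \<in> W \<and> head G e \<in> W) \<and>
     (\<forall>X. root_cut r X \<longrightarrow> X \<subseteq> W \<longrightarrow> entering F X \<noteq> {}) \<and>
     (\<forall>X. root_cut r X \<longrightarrow> k \<le> card (entering (A - F) X))"

end

section \<open>Growing disjoint branchings\<close>

context fin_digraph
begin

text \<open>Moving \<open>e\<close> into the branching costs every cut that it enters one remaining
  arc. So \<open>e\<close> must enter no cut that has only \<open>k\<close> of them.\<close>

lemma partial_branching_safe_arc:
  assumes A: "A \<subseteq> arcs G"
    and cut: "\<And>X. root_cut r X \<Longrightarrow> Suc k \<le> card (entering A X)"
    and pb: "partial_branching r A k W F" and W: "W \<noteq> verts G"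
  obtains e where "e \<in> A - F" "tail G e \<in> W" "head G e \<in> verts G - W"
    "\<And>Y. root_cut r Y \<Longrightarrow> e \<in> entering (A - F) Y \<Longrightarrow> Suc k \<le> card (entering (A - F) Y)"
proof -
  have finA: "finite A" using A by (rule finite_subset) simp
  have finAF: "finite (A - F)" using finA by simp
  have ends: "\<And>e. e \<in> F \<Longrightarrow> tail G e \<in> W \<and> head G e \<in> W" and rW: "r \<in> W" "W \<subseteq> verts G"
    and rest: "\<And>X. root_cut r X \<Longrightarrow> k \<le> card (entering (A - F) X)"
    using pb by (auto simp: partial_branching_def)
  \<comment> \<open>Cuts inside \<open>W\<close> are left out: an arc whose head lies outside
    \<open>W\<close> cannot enter them.\<close>
  define tight where
    "tight X \<longleftrightarrow> root_cut r X \<and> \<not> X \<subseteq> W \<and> card (entering (A - F) X) = k" for X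
  \<comment> \<open>Arcs of \<open>F\<close> have their heads in \<open>W\<close>, so no arc
    entering \<open>X - W\<close> has been used up.\<close>
  have outside: "entering (A - F) (X - W) = entering A (X - W)" for X
    using ends by (auto simp: entering_def)
  have not_tight: "Suc k \<le> card (entering (A - F) Y)"
    if "root_cut r Y" "\<not> Y \<subseteq> W" "\<not> tight Y" for Y
    using that rest[of Y] by (auto simp: tight_def)
  show thesis
  proof (cases "\<exists>X. tight X")
    case False
    have "root_cut r (verts G - W)" using rW W by (auto simp: root_cut_def)
    then have "0 < card (entering (A - F) (verts G - W))"
      unfolding outside using cut by fastforce
    then obtain e where e: "e \<in> entering (A - F) (verts G - W)"
      by (auto simp: card_gt_0_iff)
    show thesis
    proof (rule that[of e])
      show "e \<in> A - F" "head G e \<in> verts G - W" using e by (auto simp: entering_def)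
      then have "tail G e \<in> verts G" using A by auto
      then show "tail G e \<in> W" using e by (auto simp: entering_def)
      fix Y assume "root_cut r Y" "e \<in> entering (A - F) Y"
      then show "Suc k \<le> card (entering (A - F) Y)"
        using e False by (intro not_tight) (auto simp: entering_def)
    qed
  next
    case True
    \<comment> \<open>Least cardinality stands in for inclusion-minimality.\<close>
    then obtain X where tX: "tight X" and min: "\<And>Y. card Y < card X \<Longrightarrow> \<not> tight Y"
      using exists_least_iff[of "\<lambda>n. \<exists>X. tight X \<and> card X = n"] by blast
    have rX: "root_cut r X" using tX by (simp add: tight_def)
    have finX: "finite X" using rX finite_verts by (auto simp: root_cut_def intro: finite_subset)
    have "root_cut r (X - W)" using tX by (auto simp: tight_def root_cut_def)
    \<comment> \<open>The cut \<open>X - W\<close> still has at least \<open>k + 1\<close> arcs,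
      while \<open>X\<close> has only \<open>k\<close>. An arc that enters \<open>X - W\<close> but
      not \<open>X\<close> has its tail in \<open>X \<inter> W\<close>.\<close>
    then have "card (entering (A - F) X) < card (entering (A - F) (X - W))"
      using tX cut unfolding outside by (fastforce simp: tight_def)
    then have "\<not> entering (A - F) (X - W) \<subseteq> entering (A - F) X"
      using card_mono[OF finite_entering[OF finAF]] by (metis not_less)
    then obtain e where e: "e \<in> A - F" "head G e \<in> X - W" "tail G e \<in> X \<inter> W"
      by (auto simp: entering_def)
    show thesis
    proof (rule that[of e])
      show "e \<in> A - F" "tail G e \<in> W" using e by auto
      show "head G e \<in> verts G - W" using e rX by (auto simp: root_cut_def)
      fix Y assume Y: "root_cut r Y" "e \<in> entering (A - F) Y"
      then have "\<not> Y \<subseteq> W" using e by (auto simp: entering_def)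
      \<comment> \<open>If \<open>Y\<close> were tight, submodularity would make
        \<open>X \<inter> Y\<close> tight. The tail of \<open>e\<close> lies in \<open>X\<close> but
        not in \<open>Y\<close>, so this set is smaller than \<open>X\<close>.\<close>
      moreover have "\<not> tight Y"
      proof
        assume tY: "tight Y"
        have "root_cut r (X \<inter> Y)" "root_cut r (X \<union> Y)" "\<not> X \<inter> Y \<subseteq> W"
          using rX Y e by (auto simp: root_cut_def entering_def)
        moreover have "card (entering (A - F) (X \<inter> Y)) + card (entering (A - F) (X \<union> Y)) \<le> k + k"
          using card_entering_submodular[OF finAF, of X Y] tX tY by (simp add: tight_def)
        ultimately have "tight (X \<inter> Y)"
          using rest[of "X \<inter> Y"] rest[of "X \<union> Y"] by (simp add: tight_def)
        moreover have "card (X \<inter> Y) < card X"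
          using e Y by (intro psubset_card_mono finX) (auto simp: entering_def)
        ultimately show False using min by blast
      qed
      ultimately show "Suc k \<le> card (entering (A - F) Y)" using Y not_tight by blast
    qed
  qed
qed

text \<open>The new vertex is the head of a safe arc, and every cut that this arc enters can spare
  it.\<close>

lemma partial_branching_extend:
  assumes A: "A \<subseteq> arcs G"
    and cut: "\<And>X. root_cut r X \<Longrightarrow> Suc k \<le> card (entering A X)"
    and pb: "partial_branching r A k W F" and W: "W \<noteq> verts G"
  obtains v F' where "v \<in> verts G - W" "partial_branching r A k (insert v W) F'"
proof -
  obtain e where e: "e \<in> A - F" "tail G e \<in> W" "head G e \<in> verts G - W"
    and safe: "\<And>Y. root_cut r Y \<Longrightarrow> e \<in> entering (A - F) Y \<Longrightarrow> Suc k \<le> card (entering (A - F) Y)"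
    using partial_branching_safe_arc[OF assms] by blast
  have finAF: "finite (A - F)" using finite_subset[OF A] by simp
  have ends: "\<And>e. e \<in> F \<Longrightarrow> tail G e \<in> W \<and> head G e \<in> W"
    and hit: "\<And>X. root_cut r X \<Longrightarrow> X \<subseteq> W \<Longrightarrow> entering F X \<noteq> {}"
    and rest: "\<And>X. root_cut r X \<Longrightarrow> k \<le> card (entering (A - F) X)"
    using pb by (auto simp: partial_branching_def)
  have "entering (insert e F) X \<noteq> {}" if X: "root_cut r X" "X \<subseteq> insert (head G e) W" for X
  proof (cases "X \<inter> W = {}")
    case True
    then have "X = {head G e}" using X by (auto simp: root_cut_def)
    then have "e \<in> entering (insert e F) X" using e by (auto simp: entering_def)
    then show ?thesis by blast
  next
    case False
    \<comment> \<open>An arc of \<open>F\<close> entering \<open>X \<inter> W\<close> has its tail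
      in \<open>W\<close>, hence outside all of \<open>X\<close>.\<close>
    then have "entering F (X \<inter> W) \<noteq> {}" using X by (intro hit) (auto simp: root_cut_def)
    then show ?thesis using ends by (auto simp: entering_def)
  qed
  moreover have "k \<le> card (entering (A - insert e F) X)" if X: "root_cut r X" for X
  proof -
    have "entering (A - insert e F) X = entering (A - F) X - {e}"
      by (auto simp: entering_def)
    then show ?thesis
      using rest[OF X] safe[OF X] finite_entering[OF finAF, of X]
      by (cases "e \<in> entering (A - F) X") (auto simp: card_Diff_singleton)
  qed
  ultimately have "partial_branching r A k (insert (head G e) W) (insert e F)"
    using pb e by (auto simp: partial_branching_def)
  then show thesis using that e by blast
qed

lemma spanning_branching:
  assumes A: "A \<subseteq> arcs G" and r: "r \<in> verts G"
    and cut: "\<And>X. root_cut r X \<Longrightarrow> Suc k \<le> card (entering A X)"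
  obtains F where "partial_branching r A k (verts G) F"
proof -
  have "\<exists>F. partial_branching r A k (verts G) F" if "partial_branching r A k W F" for W F
    using that
  proof (induction "card (verts G - W)" arbitrary: W F rule: less_induct)
    case less
    show ?case
    proof (cases "W = verts G")
      case False
      then obtain v F' where v: "v \<in> verts G - W" "partial_branching r A k (insert v W) F'"
        using partial_branching_extend[OF A cut less.prems] by blast
      have "card (verts G - insert v W) < card (verts G - W)"
        using v by (intro psubset_card_mono) auto
      then show ?thesis using less.hyps v by blast
    qed (use less.prems in blast)
  qed
  \<comment> \<open>No root cut lies inside \<open>{r}\<close>, so the branching may start without
    arcs.\<close>
  moreover have "partial_branching r A k {r} {}"
    using r cut by (auto simp: partial_branching_def root_cut_def intro: Suc_leD)
  ultimately show thesis using that by blast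
qed

text \<open>As classes of one function the branchings are disjoint for free. The induction peels off
  one spanning branching whose removal leaves \<open>k\<close> arcs in every root cut.\<close>

theorem edmonds_disjoint_branchings:
  assumes "A \<subseteq> arcs G" and r: "r \<in> verts G"
    and "\<And>X. root_cut r X \<Longrightarrow> k \<le> card (entering A X)"
  shows "\<exists>f :: 'b \<Rightarrow> nat. \<forall>i<k. \<forall>X. root_cut r X \<longrightarrow> entering {e \<in> A. f e = i} X \<noteq> {}"
  using assms(1,3)
proof (induction k arbitrary: A)
  case (Suc k)
  obtain F where F: "partial_branching r A k (verts G) F"
    using spanning_branching[OF Suc.prems(1) r Suc.prems(2)] by blast
  then have "\<And>X. root_cut r X \<Longrightarrow> k \<le> card (entering (A - F) X)"
    by (simp add: partial_branching_def)
  from Suc.IH[OF _ this] obtain f :: "'b \<Rightarrow> nat" where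
    f: "\<And>i X. i < k \<Longrightarrow> root_cut r X \<Longrightarrow> entering {e \<in> A - F. f e = i} X \<noteq> {}"
    using Suc.prems(1) by (metis Diff_subset subset_trans)
  show ?case
  \<comment> \<open>The classes taken from \<open>f\<close> have colors below \<open>k\<close>, so
    \<open>k\<close> is free for \<open>F\<close>. Arcs outside \<open>F\<close> on which
    \<open>f\<close> is already \<open>k\<close> only enlarge that class.\<close>
  proof (intro exI[of _ "\<lambda>e. if e \<in> F then k else f e"] allI impI)
    fix i X assume i: "i < Suc k" and X: "root_cut r X"
    show "entering {e \<in> A. (if e \<in> F then k else f e) = i} X \<noteq> {}"
    proof (cases "i = k")
      case True
      have "X \<subseteq> verts G" using X by (auto simp: root_cut_def)
      then have "entering F X \<noteq> {}" "F \<subseteq> A"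
        using F X by (simp_all add: partial_branching_def)
      then show ?thesis using True by (auto simp: entering_def)
    next
      case False
      then have "entering {e \<in> A - F. f e = i} X \<noteq> {}" using f i X by simp
      then show ?thesis by (auto simp: entering_def)
    qed
  qed
qed simp

end

section \<open>Cuts and dipaths\<close>

lemma (in wf_digraph) awalk_enters:
  assumes "awalk u p v" "u \<notin> X" "v \<in> X"
  shows "\<exists>e \<in> set p. e \<in> entering (arcs G) X"
  using assms
proof (induction p arbitrary: u)
  case (Cons e p)
  then have "e \<in> arcs G" "tail G e = u" "awalk (head G e) p v"
    by (auto simp: awalk_Cons_iff)
  \<comment> \<open>The arc found is the first one on the walk with its head in
    \<open>X\<close>.\<close>
  then show ?case
    using Cons by (cases "head G e \<in> X") (auto simp: entering_def)
qed (auto simp: awalk_Nil_iff)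

text \<open>The easy half of Menger's theorem: each path contributes an arc entering
  \<open>X\<close>, and disjointness makes these arcs distinct.\<close>

lemma (in fin_digraph) arc_disjoint_paths_card_entering:
  assumes "\<And>i. i < k \<Longrightarrow> apath r (P i) v"
    and "\<And>i j. i < k \<Longrightarrow> j < k \<Longrightarrow> i \<noteq> j \<Longrightarrow> set (P i) \<inter> set (P j) = {}"
    and "r \<notin> X" "v \<in> X"
  shows "k \<le> card (entering (arcs G) X)"
proof -
  have "\<forall>i<k. \<exists>e. e \<in> set (P i) \<and> e \<in> entering (arcs G) X"
    using awalk_enters assms(1,3,4) unfolding apath_def by blast
  then obtain g where g: "\<And>i. i < k \<Longrightarrow> g i \<in> set (P i) \<and> g i \<in> entering (arcs G) X"
    by metis
  have "inj_on g {..<k}"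
    using g assms(2) by (force simp: inj_on_def)
  then have "card {..<k} \<le> card (entering (arcs G) X)"
    using g by (intro card_inj_on_le) (auto simp: finite_entering)
  then show ?thesis by simp
qed

text \<open>If \<open>v\<close> were unreachable, the unreachable vertices would form a root cut,
  and an arc entering it would extend a walk to one of them.\<close>

lemma (in fin_digraph) apath_of_cuts:
  assumes r: "r \<in> verts G" and v: "v \<in> verts G"
    and cut: "\<And>X. root_cut r X \<Longrightarrow> entering (arcs G) X \<noteq> {}"
  shows "\<exists>p. apath r p v"
proof (rule ccontr)
  assume no: "\<not> ?thesis"
  define R where "R = {w \<in> verts G. \<exists>p. awalk r p w}"
  have "awalk r [] r" using r by (simp add: awalk_Nil_iff)
  moreover have "v \<notin> R"
    using no apath_awalk_to_apath unfolding R_def by blast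
  ultimately have "root_cut r (verts G - R)"
    using r v by (auto simp: root_cut_def R_def)
  then obtain e where e: "e \<in> arcs G" "tail G e \<in> R" "head G e \<in> verts G - R"
    using cut[of "verts G - R"] by (auto simp: entering_def)
  then obtain p where "awalk r p (tail G e)" by (auto simp: R_def)
  then have "awalk r (p @ [e]) (head G e)"
    using e by (intro awalk_appendI[of _ _ "tail G e"]) (auto intro: arc_implies_awalk)
  then have "head G e \<in> R" using e by (auto simp only: R_def)
  then show False using e by blast
qed

section \<open>Bounds on the number of colors\<close>

lemma (in fin_digraph) fin_digraph_delete_arcs: "fin_digraph (delete_arcs G F)"
  by unfold_locales (auto simp: delete_arcs_def)

lemma (in fin_digraph) color_numbers_lower_bound:
  assumes r: "r \<in> verts G" and n: "n \<in> color_avoiding_color_numbers G r l"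
  shows "l + 1 \<le> n"
proof (rule ccontr)
  assume "\<not> l + 1 \<le> n"
  moreover obtain f :: "'b \<Rightarrow> nat" and C where n_eq: "n = card (f ` arcs G)"
    and f: "color_avoiding_rooted_1_connected G r l C f"
    using n by (auto simp: color_avoiding_color_numbers_def)
  ultimately have "f ` arcs G \<subseteq> C" "card (f ` arcs G) \<le> l"
    by (auto simp: color_avoiding_rooted_1_connected_def)
  \<comment> \<open>At most \<open>l\<close> colors occur on arcs, so all of them may be deleted at
    once, which leaves \<open>H\<close> without arcs.\<close>
  moreover define H where "H = delete_arcs G {e \<in> arcs G. f e \<in> f ` arcs G}"
  ultimately have con: "rooted_1_connected H r"
    using f unfolding color_avoiding_rooted_1_connected_def by blast
  interpret H: fin_digraph H unfolding H_def by (rule fin_digraph_delete_arcs)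
  have no_arcs: "arcs H = {}" and verts: "verts H = verts G"
    by (auto simp: H_def delete_arcs_def)
  have "verts G \<subseteq> {r}"
  proof
    fix v assume "v \<in> verts G"
    then obtain p where p: "H.awalk r p v"
      using con verts by (auto simp: rooted_1_connected_def H.apath_def)
    then have "v = r"
      using H.awalk_enters[of r p v "{v}"] no_arcs by (auto simp: H.entering_def)
    then show "v \<in> {r}" by simp
  qed
  then have "card (verts H) = 1" using r verts by (simp add: subset_singleton_iff) auto
  \<comment> \<open>A single vertex without arcs is ruled out by the loop convention.\<close>
  then show False using con no_arcs by (auto simp: rooted_1_connected_def loops_at_def)
qed

text \<open>Shared by the one-vertex and the general case: after any admissible deletion one whole
  color class survives, and \<open>cls\<close> says that this suffices. By \<open>ne\<close>, all
  \<open>l + 1\<close> colors occur.\<close>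

lemma (in fin_digraph) color_number_of_color_classes:
  fixes f :: "'b \<Rightarrow> nat"
  assumes cls: "\<And>i B. i \<le> l \<Longrightarrow> {e \<in> arcs G. f e = i} \<subseteq> arcs G - B \<Longrightarrow>
                  rooted_1_connected (delete_arcs G B) r"
    and ne: "\<And>i. i \<le> l \<Longrightarrow> \<exists>e \<in> arcs G. f e = i"
  shows "l + 1 \<in> color_avoiding_color_numbers G r l"
proof -
  \<comment> \<open>The color \<open>l\<close> absorbs the superfluous ones.\<close>
  define g where "g = (\<lambda>e. min (f e) l)"
  have "g ` arcs G = {..l}"
    using ne by (force simp: g_def image_iff)
  then have card: "card (g ` arcs G) = l + 1" by simp
  have "color_avoiding_rooted_1_connected G r l {..l} g"
    unfolding color_avoiding_rooted_1_connected_def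
  proof (intro conjI allI impI)
    show "g \<in> arcs G \<rightarrow> {..l}" by (auto simp: g_def)
    fix C' assume C': "C' \<subseteq> {..l}" "card C' \<le> l"
    \<comment> \<open>At most \<open>l\<close> of the \<open>l + 1\<close> colors are deleted, so
      some color \<open>i\<close> survives, and with it the whole class \<open>i\<close> of
      \<open>f\<close>.\<close>
    then have "C' \<noteq> {..l}" by auto
    then obtain i where "i \<le> l" "i \<notin> C'" using C' by auto
    then show "rooted_1_connected (delete_arcs G {e \<in> arcs G. g e \<in> C'}) r"
      by (intro cls[of i]) (auto simp: g_def)
  qed simp
  with card show ?thesis
    unfolding color_avoiding_color_numbers_def by (metis (mono_tags, lifting) mem_Collect_eq)
qed

theorem theorem3p14:
  fixes D :: "('a, 'b) pre_digraph" and r :: 'a and l :: nat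
  assumes "fin_digraph D"
    and "r \<in> verts D"
    and "rooted_arc_connected D r (l + 1)"
  shows "l + 1 \<in> color_avoiding_color_numbers D r l \<and>
         (\<forall>n \<in> color_avoiding_color_numbers D r l. l + 1 \<le> n)"
proof -
  interpret fin_digraph D by fact
  note r = assms(2)
  have "l + 1 \<in> color_avoiding_color_numbers D r l"
  proof (cases "card (verts D) = 1")
    case True
    then have V: "verts D = {r}" using r by (metis card_1_singletonE singletonD)
    then have loops: "loops_at D r = arcs D"
      using wellformed by (auto simp: loops_at_def)
    then have "card {..l} \<le> card (arcs D)"
      using assms(3) True by (simp add: rooted_arc_connected_def)
    then obtain h where h: "h ` {..l} \<subseteq> arcs D" "inj_on h {..l}"
      using card_le_inj[of "{..l}" "arcs D"] by auto
    \<comment> \<open>Arcs outside the image of \<open>h\<close> get an unspecified color. This is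
      harmless, since each color up to \<open>l\<close> still occurs.\<close>
    define f where "f = the_inv_into {..l} h"
    have fh: "f (h i) = i" if "i \<le> l" for i
      using that h by (simp add: f_def the_inv_into_f_f)
    show ?thesis
    proof (rule color_number_of_color_classes[of l f])
      show ne: "\<exists>e \<in> arcs D. f e = i" if "i \<le> l" for i
        using that h fh by (intro bexI[of _ "h i"]) auto
      fix i B assume i: "i \<le> l" and B: "{e \<in> arcs D. f e = i} \<subseteq> arcs D - B"
      interpret H: fin_digraph "delete_arcs D B" by (rule fin_digraph_delete_arcs)
      have VH: "verts (delete_arcs D B) = {r}" using V by (simp add: delete_arcs_def)
      then have "H.apath r [] r" by (simp add: H.apath_def H.awalk_Nil_iff)
      moreover have "loops_at (delete_arcs D B) r \<noteq> {}"
        using loops ne[OF i] B by (auto simp: loops_at_def delete_arcs_def)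
      ultimately show "rooted_1_connected (delete_arcs D B) r"
        using VH by (auto simp: rooted_1_connected_def)
    qed
  next
    case False
    then have two: "card (verts D) \<ge> 2"
      and paths: "\<And>v. v \<in> verts D - {r} \<Longrightarrow> \<exists>P :: nat \<Rightarrow> 'b list.
           (\<forall>i<l + 1. apath r (P i) v) \<and>
           (\<forall>i<l + 1. \<forall>j<l + 1. i \<noteq> j \<longrightarrow> set (P i) \<inter> set (P j) = {})"
      using assms(3) by (auto simp: rooted_arc_connected_def)
    \<comment> \<open>The disjoint paths to any one vertex of \<open>X\<close> yield the cut
      condition of Edmonds' theorem.\<close>
    have "l + 1 \<le> card (entering (arcs D) X)" if X: "root_cut r X" for X
    proof -
      obtain v where v: "v \<in> X" "v \<in> verts D - {r}" "r \<notin> X"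
        using X by (auto simp: root_cut_def)
      then show ?thesis
        using paths[OF v(2)] arc_disjoint_paths_card_entering[where v = v and X = X] by blast
    qed
    then obtain f :: "'b \<Rightarrow> nat" where
      f: "\<And>i X. i \<le> l \<Longrightarrow> root_cut r X \<Longrightarrow> entering {e \<in> arcs D. f e = i} X \<noteq> {}"
      using edmonds_disjoint_branchings[of "arcs D" r "l + 1"] r
      by (metis Suc_eq_plus1 less_Suc_eq_le order_refl)
    have "verts D \<noteq> {r}" using two by auto
    \<comment> \<open>Each color class enters this cut, so each color up to \<open>l\<close>
      occurs.\<close>
    then have cut: "root_cut r (verts D - {r})" using r by (auto simp: root_cut_def)
    show ?thesis
    proof (rule color_number_of_color_classes[of l f])
      show "\<exists>e \<in> arcs D. f e = i" if "i \<le> l" for i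
        using f[OF that cut] by (auto simp: entering_def)
      fix i B assume i: "i \<le> l" and B: "{e \<in> arcs D. f e = i} \<subseteq> arcs D - B"
      interpret H: fin_digraph "delete_arcs D B" by (rule fin_digraph_delete_arcs)
      have "\<exists>p. H.apath r p v" if "v \<in> verts D" for v
      proof (rule H.apath_of_cuts)
        show "r \<in> verts (delete_arcs D B)" "v \<in> verts (delete_arcs D B)"
          using r that by (simp_all add: delete_arcs_def)
        \<comment> \<open>Deleting arcs changes no vertices, hence no root cuts, and the surviving
          class \<open>i\<close> enters each of them.\<close>
        fix X assume "H.root_cut r X"
        then have "root_cut r X"
          unfolding root_cut_def H.root_cut_def by (simp add: delete_arcs_def)
        then have "entering {e \<in> arcs D. f e = i} X \<noteq> {}" by (rule f[OF i])
        then show "H.entering (arcs (delete_arcs D B)) X \<noteq> {}"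
          using B unfolding entering_def H.entering_def by (auto simp: delete_arcs_def)
      qed
      then show "rooted_1_connected (delete_arcs D B) r"
        using False by (simp add: rooted_1_connected_def delete_arcs_def)
    qed
  qed
  then show ?thesis using color_numbers_lower_bound[OF r] by blast
qed

end
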